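(* Let $G$ be a finite simple graph with $\gamma(G)=k$, and let $G'$ be the graph obtained from $G$ by adding one new vertex adjacent to all vertices of $G$ (a universal vertex). If there exists a free $k$-witness of $G$, then $\gamma(G')=k$; otherwise $\gamma(G')\le k+1$.
   Context: All graphs are finite, simple and undirected. A graph $G=(V,E)$ is a star-$k$-PCG if there exist a weight function $w:V\to\mathbb{R}^+$ and $k$ pairwise disjoint intervals $I_1,\dots,I_k$ such that for distinct $u,v\in V$, $uv\in E$ if and only if $w(u)+w(v)\in\bigcup_i I_i$; the weighted graph $G^w$ with these intervals is a $k$-witness. Intervals are $I_i=[a_i,b_i]$ with $b_i<a_{i+1}$. The star number $\gamma(G)$ is the least positive $k$ such that $G$ is a star-$k$-PCG. For distinct $u,v$, $w(uv)=w(u)+w(v)$. For $\gamma(G)=k$, a $k$-witness is left-free if every non-edge $e$ (pair of distinct non-adjacent vertices) satisfies $w(e)>b_1$, right-free if every non-edge $e$ satisfies $w(e)<a_k$, and free if it is left-free or right-free. *)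

theory Defs
  imports Complex_Main "Graph_Theory.Pair_Digraph"
begin

text \<open>
  A finite simple undirected graph is a \<^locale>\<open>pair_graph\<close>: finite, loop-free and symmetric,
  an edge \<open>uv\<close> being the two arcs \<open>(u, v)\<close> and \<open>(v, u)\<close>.
  The intervals are \<open>I\<^sub>i = {a i..b i}\<close> for \<open>i \<in> {1..k}\<close>; the values of \<open>a\<close> and \<open>b\<close> at other indices,
  and of \<open>w\<close> outside the vertex set, are irrelevant. Degenerate intervals \<open>a i = b i\<close> are allowed.
\<close>

definition star_witness ::
  "'a pair_pre_digraph \<Rightarrow> nat \<Rightarrow> ('a \<Rightarrow> real) \<Rightarrow> (nat \<Rightarrow> real) \<Rightarrow> (nat \<Rightarrow> real) \<Rightarrow> bool" where
  "star_witness G k w a b \<longleftrightarrow>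
     (\<forall>v\<in>pverts G. w v > 0) \<and>
     (\<forall>i\<in>{1..k}. a i \<le> b i) \<and>
     (\<forall>i\<in>{1..<k}. b i < a (i + 1)) \<and>
     (\<forall>u\<in>pverts G. \<forall>v\<in>pverts G. u \<noteq> v \<longrightarrow>
        ((u, v) \<in> parcs G \<longleftrightarrow> w u + w v \<in> (\<Union>i\<in>{1..k}. {a i..b i})))"

definition star_PCG :: "nat \<Rightarrow> 'a pair_pre_digraph \<Rightarrow> bool" where
  "star_PCG k G \<longleftrightarrow> (\<exists>w a b. star_witness G k w a b)"

definition star_number :: "'a pair_pre_digraph \<Rightarrow> nat" where
  "star_number G = (LEAST k. 0 < k \<and> star_PCG k G)"

definition left_free :: "'a pair_pre_digraph \<Rightarrow> ('a \<Rightarrow> real) \<Rightarrow> (nat \<Rightarrow> real) \<Rightarrow> bool" where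
  "left_free G w b \<longleftrightarrow>
     (\<forall>u\<in>pverts G. \<forall>v\<in>pverts G. u \<noteq> v \<and> (u, v) \<notin> parcs G \<longrightarrow> w u + w v > b 1)"

definition right_free ::
  "'a pair_pre_digraph \<Rightarrow> nat \<Rightarrow> ('a \<Rightarrow> real) \<Rightarrow> (nat \<Rightarrow> real) \<Rightarrow> bool" where
  "right_free G k w a \<longleftrightarrow>
     (\<forall>u\<in>pverts G. \<forall>v\<in>pverts G. u \<noteq> v \<and> (u, v) \<notin> parcs G \<longrightarrow> w u + w v < a k)"

definition free_witness ::
  "'a pair_pre_digraph \<Rightarrow> nat \<Rightarrow> ('a \<Rightarrow> real) \<Rightarrow> (nat \<Rightarrow> real) \<Rightarrow> (nat \<Rightarrow> real) \<Rightarrow> bool" where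
  "free_witness G k w a b \<longleftrightarrow>
     star_witness G k w a b \<and> (left_free G w b \<or> right_free G k w a)"

definition add_universal :: "'a \<Rightarrow> 'a pair_pre_digraph \<Rightarrow> 'a pair_pre_digraph" where
  "add_universal z G =
     \<lparr>pverts = insert z (pverts G),
      parcs = parcs G \<union> {z} \<times> pverts G \<union> pverts G \<times> {z}\<rparr>"

lemma pair_graph_add_universal:
  assumes "pair_graph G" and "z \<notin> pverts G"
  shows "pair_graph (add_universal z G)"
proof -
  interpret pair_graph G by fact
  show ?thesis
    using assms(2) arc_fst_in_verts arc_snd_in_verts pair_finite_verts pair_finite_arcs
      arcs_symmetric pair_no_loops
    by unfold_locales (auto simp: add_universal_def symmetric_def dest: wellformed' intro!: symI)
qed

lemma pow2_sum_eq:
  fixes i j k l :: nat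
  assumes "i < j" and "k < l" and eq: "(2::nat) ^ i + 2 ^ j = 2 ^ k + 2 ^ l"
  shows "i = k \<and> j = l"
proof -
  have less: "(2::nat) ^ p + 2 ^ q < 2 ^ r + 2 ^ s" if "p < q" "q < s" for p q r s :: nat
  proof -
    have "(2::nat) ^ p < 2 ^ q" using that by simp
    hence "(2::nat) ^ p + 2 ^ q < 2 ^ Suc q" by simp
    also have "\<dots> \<le> 2 ^ s" by (rule power_increasing) (use that in auto)
    finally show ?thesis by simp
  qed
  have "j = l"
    using less[of i j l k] less[of k l j i] assms by (metis linorder_neqE_nat nat_less_le)
  thus ?thesis using eq by simp
qed

text \<open>The minimum defining \<^const>\<open>star_number\<close> is taken over a nonempty set.\<close>

lemma ex_star_PCG:
  assumes "pair_graph G"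
  shows "\<exists>k>0. star_PCG k G"
proof -
  interpret pair_graph G by fact
  obtain f :: "'a \<Rightarrow> nat" where f: "inj_on f (pverts G)"
    using finite_imp_inj_to_nat_seg[OF pair_finite_verts] by blast
  define w where "w v = real (2 ^ f v)" for v
  define S where "S = (\<lambda>(u, v). w u + w v) ` parcs G"
  have finS: "finite S" unfolding S_def using pair_finite_arcs by simp
  have arcs: "(u, v) \<in> parcs G \<longleftrightarrow> w u + w v \<in> S"
    if uv: "u \<in> pverts G" "v \<in> pverts G" "u \<noteq> v" for u v
  proof
    assume "w u + w v \<in> S"
    then obtain x y where xy: "(x, y) \<in> parcs G" and "w u + w v = w x + w y"
      unfolding S_def by auto
    hence "real (2 ^ f u + 2 ^ f v) = real (2 ^ f x + 2 ^ f y)" by (simp add: w_def)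
    hence eq: "(2::nat) ^ f u + 2 ^ f v = 2 ^ f x + 2 ^ f y" using of_nat_eq_iff by blast
    have xV: "x \<in> pverts G" "y \<in> pverts G" "x \<noteq> y" using xy wellformed' no_loops' by auto
    have "f u \<noteq> f v" "f x \<noteq> f y" using f uv xV by (auto dest: inj_onD)
    hence "(f u = f x \<and> f v = f y) \<or> (f u = f y \<and> f v = f x)"
      using eq pow2_sum_eq[of "f u" "f v" "f x" "f y"] pow2_sum_eq[of "f v" "f u" "f x" "f y"]
        pow2_sum_eq[of "f u" "f v" "f y" "f x"] pow2_sum_eq[of "f v" "f u" "f y" "f x"]
      by (metis add.commute linorder_neqE_nat)
    hence "(u = x \<and> v = y) \<or> (u = y \<and> v = x)" using f uv xV by (auto dest: inj_onD)
    thus "(u, v) \<in> parcs G" using xy arcs_symmetric by auto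
  qed (auto simp: S_def)
  have pos: "w v > 0" for v by (simp add: w_def)
  define xs where "xs = sorted_list_of_set (insert 0 S)"
  have xs: "set xs = insert 0 S" "sorted xs" "distinct xs" 
    unfolding xs_def using finS by (simp_all del: sorted_list_of_set_insert_remove)
  have S0: "w u + w v \<in> S \<longleftrightarrow> w u + w v \<in> set xs" for u v
    using pos[of u] pos[of v] xs(1) by auto
  define a where "a i = xs ! (i - 1)" for i
  have Un: "(\<Union>i\<in>{1..length xs}. {a i..a i}) = set xs"
  proof -
    have "a ` {1..length xs} = set xs"
    proof (intro set_eqI iffI)
      fix x assume "x \<in> set xs"
      then obtain j where "j < length xs" "x = xs ! j" by (auto simp: in_set_conv_nth)
      thus "x \<in> a ` {1..length xs}" by (intro image_eqI[of _ _ "Suc j"]) (auto simp: a_def)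
    qed (auto simp: a_def)
    thus ?thesis by auto
  qed
  have "a i < a (i + 1)" if "i \<in> {1..<length xs}" for i
  proof -
    have "sorted_wrt (<) xs" using xs by (simp add: strict_sorted_iff)
    thus ?thesis using that by (auto simp: a_def sorted_wrt_iff_nth_less)
  qed
  hence "star_witness G (length xs) w a a"
    unfolding star_witness_def Un using pos arcs S0 by auto
  moreover have "length xs > 0" using xs(1) by auto
  ultimately show ?thesis unfolding star_PCG_def by blast
qed

end

theory Submission
  imports Defs
begin

text \<open>
  Restricting a witness of \<open>G'\<close> to \<open>G\<close> gives \<open>\<gamma>(G) \<le> \<gamma>(G')\<close>. For the upper bounds, the new vertex
  may be given a huge weight and its edges covered by one extra interval to the right of all sums;
  in a right-free witness the last interval can be stretched to the right instead.
  A left-free witness is first translated (\<open>w + c\<close>, with the intervals moved by \<open>2c\<close>): for large \<open>c\<close>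
  a new vertex of weight 1 has all its sums \<open>w(v) + c + 1\<close> below \<open>b\<^sub>1 + 2c\<close>, so
  stretching the first interval to the left suffices.
\<close>

text \<open>Shared last step of all three constructions. Once the intervals cover every sum with the
  new weight \<open>M\<close>, pairs at \<open>z\<close> are edges as required, and pairs inside
  \<open>G\<close> keep their sums because \<open>z\<close> is a fresh vertex.\<close>

lemma star_witness_add_universal:
  assumes "star_witness G k w a b" and "z \<notin> pverts G" and "M > 0"
    and "\<forall>v\<in>pverts G. M + w v \<in> (\<Union>i\<in>{1..k}. {a i..b i})"
  shows "star_witness (add_universal z G) k (w(z := M)) a b"
  unfolding star_witness_def
proof (intro conjI ballI impI)
  fix u v
  assume uv: "u \<in> pverts (add_universal z G)" "v \<in> pverts (add_universal z G)" "u \<noteq> v"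
  show "(u, v) \<in> parcs (add_universal z G) \<longleftrightarrow>
    (w(z := M)) u + (w(z := M)) v \<in> (\<Union>i\<in>{1..k}. {a i..b i})"
  proof (cases "u = z \<or> v = z")
    case True
    hence "(w(z := M)) u + (w(z := M)) v \<in> (\<Union>i\<in>{1..k}. {a i..b i})"
      using uv assms(4) by (auto simp: add_universal_def add.commute simp del: UN_iff)
    with True uv show ?thesis by (auto simp: add_universal_def simp del: UN_iff)
  next
    case False
    with uv assms(1) show ?thesis
      by (auto simp: star_witness_def add_universal_def simp del: UN_iff)
  qed
qed (use assms(1,3) in \<open>auto simp: star_witness_def add_universal_def\<close>)

lemma star_PCG_of_add_universal:
  assumes "star_PCG k (add_universal z G)" and "z \<notin> pverts G"
  shows "star_PCG k G"
proof -
  obtain w a b where "star_witness (add_universal z G) k w a b"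
    using assms(1) by (auto simp: star_PCG_def)
  moreover have "(u, v) \<in> parcs (add_universal z G) \<longleftrightarrow> (u, v) \<in> parcs G"
    if "u \<in> pverts G" "v \<in> pverts G" for u v
    using that assms(2) by (auto simp: add_universal_def)
  ultimately have "star_witness G k w a b"
    by (simp add: star_witness_def add_universal_def del: UN_iff)
  thus ?thesis by (auto simp: star_PCG_def)
qed

lemma vertex_weights_bounded:
  fixes w :: "'a \<Rightarrow> real"
  assumes "pair_graph G"
  obtains W where "W > 0" and "\<forall>v\<in>pverts G. w v \<le> W"
proof -
  interpret pair_graph G by fact
  obtain B where "\<forall>x\<in>w ` pverts G. x \<le> B"
    using bdd_above_finite[of "w ` pverts G"] by (auto simp: bdd_above_def)
  \<comment> \<open>The maximum with 1 makes the bound positive even when there are no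
    vertices.\<close>
  thus ?thesis using that[of "max B 1"] by force
qed

lemma star_PCG_Suc_add_universal:
  assumes "pair_graph G" and "z \<notin> pverts G" and "star_PCG k G"
  shows "star_PCG (k + 1) (add_universal z G)"
proof -
  obtain w a b where wit: "star_witness G k w a b"
    using assms(3) by (auto simp: star_PCG_def)
  obtain W where W: "W > 0" "\<forall>v\<in>pverts G. w v \<le> W"
    using vertex_weights_bounded[OF assms(1)] .
  \<comment> \<open>The term \<open>2 * W\<close> puts \<open>M\<close> above every sum of two old
    weights, and \<open>\<bar>b k\<bar>\<close> puts it to the right of the last interval. Since old
    weights lie between 0 and \<open>W\<close>, all sums at \<open>z\<close> fall into
    \<open>{M..M + W}\<close>.\<close>
  define M where "M = \<bar>b k\<bar> + 2 * W + 1"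
  let ?a = "a(k + 1 := M)" and ?b = "b(k + 1 := M + W)"
  have pos: "\<forall>v\<in>pverts G. w v > 0" using wit by (simp add: star_witness_def)
  have Un: "(\<Union>i\<in>{1..k+1}. {?a i..?b i}) = (\<Union>i\<in>{1..k}. {a i..b i}) \<union> {M..M + W}"
    by (auto simp: atLeastAtMostSuc_conv)
  have below: "w u + w v \<notin> {M..M + W}" if "u \<in> pverts G" "v \<in> pverts G" for u v
  proof -
    have "w u \<le> W" "w v \<le> W" using that W by auto
    hence "w u + w v < M" unfolding M_def by linarith
    thus ?thesis by simp
  qed
  have "b k < M" unfolding M_def using W(1) by linarith
  have "star_witness G (k + 1) w ?a ?b"
    unfolding star_witness_def Un
  proof (intro conjI ballI impI)
    fix i assume "i \<in> {1..k + 1}"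
    thus "?a i \<le> ?b i" using wit W(1) by (auto simp: star_witness_def)
  next
    fix i assume "i \<in> {1..<k + 1}"
    thus "?b i < ?a (i + 1)" using wit \<open>b k < M\<close> by (cases "i = k") (auto simp: star_witness_def)
  next
    fix u v assume "u \<in> pverts G" "v \<in> pverts G" "u \<noteq> v"
    thus "(u, v) \<in> parcs G \<longleftrightarrow> w u + w v \<in> (\<Union>i\<in>{1..k}. {a i..b i}) \<union> {M..M + W}"
      using wit below[of u v] unfolding star_witness_def by blast
  qed (use pos in blast)
  hence "star_witness (add_universal z G) (k + 1) (w(z := M)) ?a ?b"
  proof (rule star_witness_add_universal[OF _ assms(2)])
    show "M > 0" using W by (simp add: M_def)
    show "\<forall>v\<in>pverts G. M + w v \<in> (\<Union>i\<in>{1..k+1}. {?a i..?b i})"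
      unfolding Un using pos W by (auto intro: less_imp_le simp del: UN_iff)
  qed
  thus ?thesis by (auto simp: star_PCG_def)
qed

lemma star_PCG_add_universal_right_free:
  assumes "pair_graph G" and "z \<notin> pverts G" and "k > 0"
    and wit: "star_witness G k w a b" and free: "right_free G k w a"
  shows "star_PCG k (add_universal z G)"
proof -
  obtain W where W: "W > 0" "\<forall>v\<in>pverts G. w v \<le> W"
    using vertex_weights_bounded[OF assms(1)] .
  \<comment> \<open>Here \<open>M\<close> need not exceed the old sums: right-freeness keeps
    non-edges below \<open>a k\<close>, so only edges can enter the stretched interval. It suffices
    that \<open>M\<close> is at least \<open>a k\<close> and \<open>M + W\<close> at least
    \<open>b k\<close>.\<close>
  define M where "M = \<bar>a k\<bar> + \<bar>b k\<bar> + 1"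
  let ?b = "b(k := M + W)"
  have pos: "\<forall>v\<in>pverts G. w v > 0" using wit by (simp add: star_witness_def)
  have le: "b k \<le> M + W" "a k \<le> M" using W by (auto simp: M_def)
  have Un: "(\<Union>i\<in>{1..k}. {a i..?b i}) = (\<Union>i\<in>{1..k}. {a i..b i}) \<union> {a k..M + W}"
    using \<open>k > 0\<close> le by (fastforce split: if_splits)
  have "star_witness G k w a ?b"
    unfolding star_witness_def Un
    using wit W(1) le free
    by (force simp: star_witness_def right_free_def simp del: UN_iff)
  hence "star_witness (add_universal z G) k (w(z := M)) a ?b"
  proof (rule star_witness_add_universal[OF _ assms(2)])
    show "M > 0" by (simp add: M_def)
    show "\<forall>v\<in>pverts G. M + w v \<in> (\<Union>i\<in>{1..k}. {a i..?b i})"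
      unfolding Un using pos W le by (force simp del: UN_iff)
  qed
  thus ?thesis by (auto simp: star_PCG_def)
qed

lemma star_witness_translate:
  assumes "star_witness G k w a b" and "c \<ge> 0"
  shows "star_witness G k (\<lambda>v. w v + c) (\<lambda>i. a i + 2 * c) (\<lambda>i. b i + 2 * c)"
proof -
  have "(w u + c) + (w v + c) \<in> (\<Union>i\<in>{1..k}. {a i + 2 * c..b i + 2 * c}) \<longleftrightarrow>
    w u + w v \<in> (\<Union>i\<in>{1..k}. {a i..b i})" for u v
    by auto
  with assms show ?thesis
    by (auto simp: star_witness_def add_pos_nonneg simp del: UN_iff)
qed

text \<open>Translation makes room on the left: in the original witness some old weight may already
  exceed \<open>b 1\<close>, leaving no positive weight for \<open>z\<close> with all its sums at
  most \<open>b 1\<close>.\<close>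

lemma star_PCG_add_universal_left_free:
  assumes "pair_graph G" and "z \<notin> pverts G" and "k > 0"
    and wit: "star_witness G k w a b" and free: "left_free G w b"
  shows "star_PCG k (add_universal z G)"
proof -
  obtain W where W: "W > 0" "\<forall>v\<in>pverts G. w v \<le> W"
    using vertex_weights_bounded[OF assms(1)] .
  \<comment> \<open>Chosen so that \<open>w v + 1 \<le> b 1 + c\<close>, which after translation
    reads \<open>1 + w' v \<le> b' 1\<close>; it also gives \<open>b' 1 \<ge> 0\<close>.\<close>
  define c where "c = \<bar>b 1\<bar> + W + 1"
  define w' where "w' v = w v + c" for v
  define a' where "a' i = a i + 2 * c" for i :: nat
  define b' where "b' i = b i + 2 * c" for i :: nat
  \<comment> \<open>The value 0 lies below all sums of positive weights; the minimum ensures that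
    the new first interval contains the old one.\<close>
  let ?a = "a'(1 := min 0 (a' 1))"
  have c: "c \<ge> 0" using W by (simp add: c_def)
  have wit': "star_witness G k w' a' b'"
    using star_witness_translate[OF wit c] by (simp add: w'_def[abs_def] a'_def[abs_def] b'_def[abs_def])
  have free': "left_free G w' b'"
    using free by (auto simp: left_free_def w'_def b'_def)
  have b1: "b' 1 \<ge> 0" using W by (simp add: b'_def c_def)
  have pos: "\<forall>v\<in>pverts G. w' v > 0" using wit' by (simp add: star_witness_def)
  have Un: "(\<Union>i\<in>{1..k}. {?a i..b' i}) = (\<Union>i\<in>{1..k}. {a' i..b' i}) \<union> {min 0 (a' 1)..b' 1}"
  proof (intro equalityI subsetI)
    fix x assume "x \<in> (\<Union>i\<in>{1..k}. {?a i..b' i})"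
    then obtain i where "i \<in> {1..k}" "x \<in> {?a i..b' i}" by blast
    thus "x \<in> (\<Union>i\<in>{1..k}. {a' i..b' i}) \<union> {min 0 (a' 1)..b' 1}"
      by (cases "i = 1") auto
  next
    fix x assume "x \<in> (\<Union>i\<in>{1..k}. {a' i..b' i}) \<union> {min 0 (a' 1)..b' 1}"
    then consider i where "i \<in> {1..k}" "x \<in> {a' i..b' i}" | "x \<in> {min 0 (a' 1)..b' 1}"
      by blast
    thus "x \<in> (\<Union>i\<in>{1..k}. {?a i..b' i})"
    proof cases
      case (1 i)
      hence "x \<in> {?a i..b' i}" by (cases "i = 1") auto
      with 1 show ?thesis by blast
    next
      case 2
      hence "x \<in> {?a 1..b' 1}" by simp
      moreover have "1 \<in> {1..k}" using \<open>k > 0\<close> by simp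
      ultimately show ?thesis by blast
    qed
  qed
  have "star_witness G k w' ?a b'"
    unfolding star_witness_def Un
  proof (intro conjI ballI impI)
    fix i assume "i \<in> {1..k}"
    hence "a' i \<le> b' i" using wit' by (simp add: star_witness_def)
    thus "?a i \<le> b' i" using b1 by (simp add: min.coboundedI1)
  next
    fix i assume "i \<in> {1..<k}"
    \<comment> \<open>Only the left end at index 1 was changed, and \<open>i + 1\<close> is at least
      2.\<close>
    thus "b' i < ?a (i + 1)" using wit' by (simp add: star_witness_def)
  next
    fix u v assume uv: "u \<in> pverts G" "v \<in> pverts G" "u \<noteq> v"
    hence "(u, v) \<in> parcs G \<longleftrightarrow> w' u + w' v \<in> (\<Union>i\<in>{1..k}. {a' i..b' i})"
      using wit' unfolding star_witness_def by blast
    moreover have "w' u + w' v \<notin> {min 0 (a' 1)..b' 1}" if "(u, v) \<notin> parcs G"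
      using free' uv that by (force simp: left_free_def)
    ultimately show "(u, v) \<in> parcs G \<longleftrightarrow>
        w' u + w' v \<in> (\<Union>i\<in>{1..k}. {a' i..b' i}) \<union> {min 0 (a' 1)..b' 1}"
      by blast
  qed (use pos in blast)
  hence "star_witness (add_universal z G) k (w'(z := 1)) ?a b'"
  proof (rule star_witness_add_universal[OF _ assms(2)])
    have "1 + w' v \<in> {min 0 (a' 1)..b' 1}" if "v \<in> pverts G" for v
    proof -
      have "w v \<le> W" "w' v > 0" using that W pos by auto
      thus ?thesis by (auto simp: w'_def b'_def c_def)
    qed
    thus "\<forall>v\<in>pverts G. 1 + w' v \<in> (\<Union>i\<in>{1..k}. {?a i..b' i})"
      unfolding Un by blast
  qed simp
  thus ?thesis by (auto simp: star_PCG_def)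
qed

lemma star_number_works:
  assumes "pair_graph G"
  shows "0 < star_number G \<and> star_PCG (star_number G) G"
  unfolding star_number_def by (rule LeastI_ex) (use ex_star_PCG[OF assms] in blast)

lemma star_number_le: "0 < k \<Longrightarrow> star_PCG k G \<Longrightarrow> star_number G \<le> k"
  unfolding star_number_def by (rule Least_le) simp

theorem theorem3:
  fixes G :: "'a pair_pre_digraph" and z :: 'a and k :: nat
  assumes "pair_graph G"
    and "star_number G = k"
    and "z \<notin> pverts G"
  shows "((\<exists>w a b. free_witness G k w a b) \<longrightarrow> star_number (add_universal z G) = k) \<and>
         ((\<nexists>w a b. free_witness G k w a b) \<longrightarrow> star_number (add_universal z G) \<le> k + 1)"
proof (intro conjI impI)
  have k: "0 < k" "star_PCG k G" using star_number_works[OF assms(1)] assms(2) by auto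
  show "star_number (add_universal z G) \<le> k + 1"
    using star_PCG_Suc_add_universal[OF assms(1,3) k(2)] by (intro star_number_le) auto
  assume "\<exists>w a b. free_witness G k w a b"
  hence "star_PCG k (add_universal z G)"
    using star_PCG_add_universal_left_free[OF assms(1,3) k(1)]
      star_PCG_add_universal_right_free[OF assms(1,3) k(1)]
    by (auto simp: free_witness_def)
  hence "star_number (add_universal z G) \<le> k" using k(1) by (rule star_number_le[rotated])
  \<comment> \<open>The star number of the extended graph is attained by some witness; restricted to
    \<open>G\<close>, it contradicts minimality of \<open>k\<close> if it has fewer than
    \<open>k\<close> intervals.\<close>
  moreover have "k \<le> star_number (add_universal z G)"
    using star_number_works[OF pair_graph_add_universal[OF assms(1,3)]]
      star_PCG_of_add_universal[OF _ assms(3)] star_number_le assms(2) by blast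
  ultimately show "star_number (add_universal z G) = k" by (rule antisym)
qed

end
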